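(* Let $\delta\ge 1$ and $\lambda>0$ be real numbers, and for $x>0$ let $$f_x(y)=\frac{2\lambda x^2}{y^3}\exp\Big(-\frac{\lambda x^2}{y^2}\Big)1_{(0,\infty)}(y).$$ Let $y>0$. For every integer $i\ge 0$ and every $\sigma>0$, $$\varphi_y\big(\nu^{i,(\delta)}_\sigma\big)=\nu^{i+1,(\delta)}_{T_y(\sigma)},\qquad T_y(\sigma)=\frac{\sigma y}{(y^2+2\lambda\sigma^2)^{1/2}} .$$ Thus the updating operator maps $\mathcal F^{(\delta)}=\{\nu^{i,(\delta)}_\sigma: i\ge 0,\ \sigma>0\}$ into itself, the index being transformed by the one-to-one map $t_y(i)=t(i)=i+1$, which does not depend on $\sigma$, and the parameter being transformed by $T_y$, which does not depend on $i$.
   Context: $f_x(y)\,dy$ is the law of $x\,w$, where $w$ has the distribution of $\Gamma^{-1/2}$ with $\Gamma$ exponential with parameter $\lambda$. For a probability measure $\nu$ on $(0,\infty)$, the updating operator is $\varphi_y(\nu)(dx)=f_x(y)\nu(dx)/p_\nu(y)$ with $p_\nu(y)=\int_0^\infty\nu(d\xi)f_\xi(y)$. For $\alpha\ge 0$, $C_\alpha=\mathbb E|X|^\alpha$ with $X$ a standard Gaussian random variable. For $i\ge 0$, $\sigma>0$, $$\nu^{i,(\delta)}_\sigma(dx)=1_{(x>0)}\frac{2}{\sigma(2\pi)^{1/2}}\,\frac{x^{\delta-1+2i}}{C_{\delta-1+2i}\,\sigma^{\delta-1+2i}}\exp\Big(-\frac{x^2}{2\sigma^2}\Big)dx,$$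 which is a probability measure on $(0,\infty)$. *)

theory Defs
  imports "HOL-Probability.Probability"
begin

text \<open>
  Measures on $(0,\infty)$ are represented as Borel measures on the real line
  concentrated on \<^term>\<open>{0<..} :: real set\<close>.
\<close>

definition lik :: "real \<Rightarrow> real \<Rightarrow> real \<Rightarrow> real" where
  "lik lam x y = 2 * lam * x\<^sup>2 / y ^ 3 * exp (- (lam * x\<^sup>2 / y\<^sup>2)) * indicator {0<..} y"

text \<open>
  The normalising constant $p_\nu(y)$ is a nonnegative Lebesgue integral, with values in
  \<^typ>\<open>ennreal\<close>, so that no integrability side condition is hidden in the definition.
\<close>

definition marginal :: "(real \<Rightarrow> real \<Rightarrow> real) \<Rightarrow> real measure \<Rightarrow> real \<Rightarrow> ennreal" where
  "marginal f \<nu> y = (\<integral>\<^sup>+ \<xi>\<in>{0<..}. ennreal (f \<xi> y) \<partial>\<nu>)"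

definition update :: "(real \<Rightarrow> real \<Rightarrow> real) \<Rightarrow> real \<Rightarrow> real measure \<Rightarrow> real measure" where
  "update f y \<nu> = density \<nu> (\<lambda>x. ennreal (f x y) / marginal f \<nu> y)"

definition gauss_moment :: "real \<Rightarrow> real" where
  "gauss_moment \<alpha> = (\<integral>x. \<bar>x\<bar> powr \<alpha> \<partial>density lborel (\<lambda>x. ennreal (std_normal_density x)))"

definition nu :: "real \<Rightarrow> nat \<Rightarrow> real \<Rightarrow> real measure" where
  "nu \<delta> i \<sigma> = density lborel (\<lambda>x. ennreal (indicator {0<..} x *
     (2 / (\<sigma> * sqrt (2 * pi))) *
     (x powr (\<delta> - 1 + 2 * real i) /
       (gauss_moment (\<delta> - 1 + 2 * real i) * \<sigma> powr (\<delta> - 1 + 2 * real i))) *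
     exp (- (x\<^sup>2 / (2 * \<sigma>\<^sup>2)))))"

definition nu_family :: "real \<Rightarrow> real measure set" where
  "nu_family \<delta> = {nu \<delta> i \<sigma> | i \<sigma>. \<sigma> > 0}"

definition index_map :: "nat \<Rightarrow> nat" where
  "index_map i = i + 1"

definition param_map :: "real \<Rightarrow> real \<Rightarrow> real \<Rightarrow> real" where
  "param_map lam y \<sigma> = \<sigma> * y / sqrt (y\<^sup>2 + 2 * lam * \<sigma>\<^sup>2)"

text \<open>
  The measures \<open>nu\<close> are genuine probability measures on $(0,\infty)$; in particular, the
  Gaussian moment is finite and positive, so the division in \<open>nu_def\<close> is never by zero.
\<close>

lemma integrable_gauss_abs_powr:
  assumes "a \<ge> 0"
  shows "integrable lborel (\<lambda>x. std_normal_density x * \<bar>x\<bar> powr a)"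
proof (rule Bochner_Integration.integrable_bound)
  define n where "n = nat \<lceil>a\<rceil>"
  have n: "a \<le> real n" unfolding n_def using assms by linarith
  show "integrable lborel (\<lambda>x. std_normal_density x * \<bar>x\<bar> ^ n + std_normal_density x)"
    using integrable_std_normal_moment_abs[of n] integrable_normal_density[of 1 0]
    by (intro Bochner_Integration.integrable_add) auto
  show "AE x in lborel. norm (std_normal_density x * \<bar>x\<bar> powr a)
      \<le> norm (std_normal_density x * \<bar>x\<bar> ^ n + std_normal_density x)"
  proof (rule AE_I2)
    fix x :: real
    have "\<bar>x\<bar> powr a \<le> \<bar>x\<bar> ^ n + 1"
    proof (cases "\<bar>x\<bar> \<ge> 1")
      case True
      then have "\<bar>x\<bar> powr a \<le> \<bar>x\<bar> powr real n" using n by (intro powr_mono) auto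
      also have "\<dots> = \<bar>x\<bar> ^ n" using True by (intro powr_realpow) linarith
      finally show ?thesis by simp
    next
      case False
      then have "\<bar>x\<bar> powr a \<le> 1" using assms by (intro powr_le1) auto
      moreover have "0 \<le> \<bar>x\<bar> ^ n" by simp
      ultimately show ?thesis by linarith
    qed
    then have "std_normal_density x * \<bar>x\<bar> powr a \<le> std_normal_density x * (\<bar>x\<bar> ^ n + 1)"
      by (intro mult_left_mono) auto
    then show "norm (std_normal_density x * \<bar>x\<bar> powr a)
      \<le> norm (std_normal_density x * \<bar>x\<bar> ^ n + std_normal_density x)"
      by (simp add: algebra_simps abs_mult)
  qed
qed simp

lemma gauss_moment_eq:
  "gauss_moment a = (\<integral>x. std_normal_density x * \<bar>x\<bar> powr a \<partial>lborel)"
  unfolding gauss_moment_def by (subst integral_density) auto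

lemma gauss_moment_pos:
  assumes "a \<ge> 0"
  shows "gauss_moment a > 0"
proof -
  have nn: "AE x in lborel. 0 \<le> std_normal_density x * \<bar>x\<bar> powr a" by simp
  have "\<not> (AE x in lborel. std_normal_density x * \<bar>x\<bar> powr a = 0)"
  proof
    assume "AE x in lborel. std_normal_density x * \<bar>x\<bar> powr a = 0"
    then have "AE x in lborel. x = (0::real)"
      by eventually_elim (auto simp: normal_density_def)
    moreover have "AE x in lborel. x \<noteq> (0::real)" by (rule AE_lborel_singleton)
    ultimately have "AE x in (lborel::real measure). False" by eventually_elim auto
    then show False by (simp add: AE_iff_null emeasure_lborel_UNIV null_sets_def)
  qed
  then have "gauss_moment a \<noteq> 0" unfolding gauss_moment_eq
    using integral_nonneg_eq_0_iff_AE[OF integrable_gauss_abs_powr[OF assms] nn] by simp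
  moreover have "gauss_moment a \<ge> 0" unfolding gauss_moment_eq by (rule integral_nonneg_AE[OF nn])
  ultimately show ?thesis by simp
qed

lemma half_gauss_moment:
  assumes "a \<ge> 0"
  shows "(\<integral>\<^sup>+x. ennreal (indicator {0<..} x * std_normal_density x * \<bar>x\<bar> powr a) \<partial>lborel)
     = ennreal (gauss_moment a / 2)"
proof -
  let ?g = "\<lambda>x::real. std_normal_density x * \<bar>x\<bar> powr a"
  let ?h = "\<lambda>x::real. ennreal (indicator {0<..} x * ?g x)"
  have "ennreal (gauss_moment a) = (\<integral>\<^sup>+x. ennreal (?g x) \<partial>lborel)"
    unfolding gauss_moment_eq
    by (rule nn_integral_eq_integral[symmetric, OF integrable_gauss_abs_powr[OF assms]]) simp
  also have "\<dots> = (\<integral>\<^sup>+x. ?h x + ?h (0 + (-1) * x) \<partial>lborel)"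
    by (rule nn_integral_cong_AE, rule AE_mp[OF AE_lborel_singleton[of 0]])
       (auto simp: normal_density_def split: split_indicator)
  also have "\<dots> = (\<integral>\<^sup>+x. ?h x \<partial>lborel) + (\<integral>\<^sup>+x. ?h (0 + (-1) * x) \<partial>lborel)"
    by (intro nn_integral_add) auto
  also have "(\<integral>\<^sup>+x. ?h (0 + (-1) * x) \<partial>lborel) = (\<integral>\<^sup>+x. ?h x \<partial>lborel)"
    using nn_integral_real_affine[of ?h "-1" 0] by simp
  finally have e: "ennreal (gauss_moment a) = (\<integral>\<^sup>+x. ?h x \<partial>lborel) + (\<integral>\<^sup>+x. ?h x \<partial>lborel)" .
  then have "(\<integral>\<^sup>+x. ?h x \<partial>lborel) \<noteq> \<top>" by auto
  then obtain r where r: "(\<integral>\<^sup>+x. ?h x \<partial>lborel) = ennreal r" "r \<ge> 0"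
    by (cases "\<integral>\<^sup>+x. ?h x \<partial>lborel") auto
  have "gauss_moment a = r + r"
    using e r gauss_moment_pos[OF assms] by (simp add: ennreal_plus[symmetric] del: ennreal_plus)
  then show ?thesis using r by (simp add: mult.assoc)
qed

lemma prob_space_nu:
  assumes "\<delta> \<ge> 1" "\<sigma> > 0"
  shows "prob_space (nu \<delta> i \<sigma>)" and "emeasure (nu \<delta> i \<sigma>) {0<..} = 1"
proof -
  define a where "a = \<delta> - 1 + 2 * real i"
  have a: "a \<ge> 0" using assms by (simp add: a_def)
  note C = gauss_moment_pos[OF a]
  let ?d = "\<lambda>x::real. indicator {0<..} x * (2 / (\<sigma> * sqrt (2 * pi))) *
     (x powr a / (gauss_moment a * \<sigma> powr a)) * exp (- (x\<^sup>2 / (2 * \<sigma>\<^sup>2)))"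
  have eq: "\<bar>\<sigma>\<bar> * ?d (0 + \<sigma> * x) =
      2 / gauss_moment a * (indicator {0<..} x * std_normal_density x * \<bar>x\<bar> powr a)" for x
    using assms C
    by (auto simp: normal_density_def powr_mult power_mult_distrib zero_less_mult_iff mult_ac split: split_indicator)
  have "(\<integral>\<^sup>+x. ennreal (?d x) \<partial>lborel) = ennreal \<bar>\<sigma>\<bar> * (\<integral>\<^sup>+x. ennreal (?d (0 + \<sigma> * x)) \<partial>lborel)"
    using assms by (intro nn_integral_real_affine) auto
  also have "\<dots> = (\<integral>\<^sup>+x. ennreal (\<bar>\<sigma>\<bar> * ?d (0 + \<sigma> * x)) \<partial>lborel)"
    by (subst nn_integral_cmult[symmetric]) (auto simp: ennreal_mult'[symmetric])
  also have "\<dots> = (\<integral>\<^sup>+x. ennreal (2 / gauss_moment a) *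
       ennreal (indicator {0<..} x * std_normal_density x * \<bar>x\<bar> powr a) \<partial>lborel)"
    unfolding eq using C by (intro nn_integral_cong, subst ennreal_mult'[symmetric]) auto
  also have "\<dots> = ennreal (2 / gauss_moment a) * ennreal (gauss_moment a / 2)"
    by (subst nn_integral_cmult) (auto simp: half_gauss_moment[OF a])
  also have "\<dots> = 1" using C by (simp add: ennreal_mult'[symmetric])
  finally have 1: "(\<integral>\<^sup>+x. ennreal (?d x) \<partial>lborel) = 1" .
  show "prob_space (nu \<delta> i \<sigma>)"
    by (rule prob_spaceI) (use 1 in \<open>simp add: nu_def a_def[symmetric] emeasure_density\<close>)
  have "emeasure (nu \<delta> i \<sigma>) {0<..} = (\<integral>\<^sup>+x. ennreal (?d x) * indicator {0<..} x \<partial>lborel)"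
    by (simp add: nu_def a_def[symmetric] emeasure_density)
  also have "\<dots> = (\<integral>\<^sup>+x. ennreal (?d x) \<partial>lborel)"
    by (intro nn_integral_cong) (auto split: split_indicator)
  finally show "emeasure (nu \<delta> i \<sigma>) {0<..} = 1" using 1 by simp
qed

end

theory Submission
  imports Defs
begin

text \<open>
  The updated density is known as soon as likelihood times prior density is a constant multiple
  of some probability density, because the marginal is then that constant. For
  \<open>\<nu>\<^sup>i\<^sub>\<sigma>\<close> the factor \<open>x\<^sup>2\<close> of the likelihood raises the exponent of \<open>x\<close> by 2, i.e. \<open>i\<close> by 1,
  and the Gaussian factors combine because \<open>1/(2 T\<^sup>2) = 1/(2 \<sigma>\<^sup>2) + \<lambda>/y\<^sup>2\<close> with \<open>T = T\<^sub>y(\<sigma>)\<close>.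
\<close>

lemma update_density:
  fixes p q :: "real \<Rightarrow> real"
  assumes [measurable]: "p \<in> borel_measurable M" "q \<in> borel_measurable M"
      "(\<lambda>x. f x y) \<in> borel_measurable M" "{0<..} \<in> sets M"
    and p: "\<And>x. p x \<ge> 0" and K: "K > 0"
    and bayes: "\<And>x. f x y * p x = K * q x"
    and q0: "\<And>x. x \<le> 0 \<Longrightarrow> q x = 0"
    and q1: "(\<integral>\<^sup>+x. ennreal (q x) \<partial>M) = 1"
  shows "update f y (density M (\<lambda>x. ennreal (p x))) = density M (\<lambda>x. ennreal (q x))"
proof -
  \<comment> \<open>\<open>ennreal\<close> splits over a product once one factor is nonnegative:
    \<open>p x\<close> on the left, \<open>K\<close> on the right.\<close>
  have e: "ennreal (p x) * ennreal (f x y) = ennreal K * ennreal (q x)" for x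
    using bayes[of x] p[of x] K by (metis ennreal_mult' ennreal_mult'' less_imp_le mult.commute)
  have "marginal f (density M (\<lambda>x. ennreal (p x))) y
      = (\<integral>\<^sup>+x. ennreal (p x) * (ennreal (f x y) * indicator {0<..} x) \<partial>M)"
    unfolding marginal_def by (subst nn_integral_density) auto
  \<comment> \<open>On the positive axis this is \<open>e\<close>; elsewhere the indicator kills the
    left integrand and \<open>q0\<close> the right one.\<close>
  also have "\<dots> = (\<integral>\<^sup>+x. ennreal K * ennreal (q x) \<partial>M)"
    by (intro nn_integral_cong) (auto simp: e q0 mult.assoc[symmetric] split: split_indicator)
  also have "\<dots> = ennreal K"
    by (subst nn_integral_cmult) (simp_all add: q1)
  finally have m: "marginal f (density M (\<lambda>x. ennreal (p x))) y = ennreal K" .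
  \<comment> \<open>\<open>ennreal K\<close> is neither 0 nor infinite, so it cancels.\<close>
  have "ennreal (p x) * (ennreal (f x y) / ennreal K) = ennreal (q x)" for x
    using K by (simp add: ennreal_times_divide e ennreal_mult_divide_eq mult.commute[of "ennreal K"])
  then show ?thesis
    unfolding update_def m by (subst density_density_eq) auto
qed

text \<open>Real-valued, so that the algebra of Bayes' rule can be done in the field of reals before
  passing to \<open>ennreal\<close>.\<close>

definition nu_density :: "real \<Rightarrow> nat \<Rightarrow> real \<Rightarrow> real \<Rightarrow> real" where
  "nu_density \<delta> i \<sigma> x = indicator {0<..} x * (2 / (\<sigma> * sqrt (2 * pi))) *
     (x powr (\<delta> - 1 + 2 * real i) /
       (gauss_moment (\<delta> - 1 + 2 * real i) * \<sigma> powr (\<delta> - 1 + 2 * real i))) *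
     exp (- (x\<^sup>2 / (2 * \<sigma>\<^sup>2)))"

lemma nu_eq_density: "nu \<delta> i \<sigma> = density lborel (\<lambda>x. ennreal (nu_density \<delta> i \<sigma> x))"
  by (simp add: nu_def nu_density_def)

lemma borel_measurable_nu_density [measurable]: "nu_density \<delta> i \<sigma> \<in> borel_measurable borel"
  unfolding nu_density_def by measurable

lemma nu_density_nonneg:
  assumes "\<delta> \<ge> 1" "\<sigma> > 0"
  shows "nu_density \<delta> i \<sigma> x \<ge> 0"
  using assms gauss_moment_pos[of "\<delta> - 1 + 2 * real i"] by (simp add: nu_density_def)

lemma nn_integral_nu_density:
  assumes "\<delta> \<ge> 1" "\<sigma> > 0"
  shows "(\<integral>\<^sup>+x. ennreal (nu_density \<delta> i \<sigma> x) \<partial>lborel) = 1"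
  using prob_space.emeasure_space_1[OF prob_space_nu(1)[OF assms, of i]]
  by (simp add: nu_eq_density emeasure_density)

lemma param_map_pos:
  assumes "lam > 0" "y > 0" "\<sigma> > 0"
  shows "param_map lam y \<sigma> > 0"
  using assms by (simp add: param_map_def add_pos_pos)

text \<open>Inverting the closed form of the squared parameter turns the sum in its denominator into
  a sum of precisions.\<close>

lemma precision_param_map:
  assumes "lam > 0" "y > 0" "\<sigma> > 0"
  shows "x\<^sup>2 / (2 * (param_map lam y \<sigma>)\<^sup>2) = lam * x\<^sup>2 / y\<^sup>2 + x\<^sup>2 / (2 * \<sigma>\<^sup>2)"
proof -
  have "y\<^sup>2 + 2 * lam * \<sigma>\<^sup>2 > 0"
    using assms by (simp add: add_pos_pos)
  then have "(param_map lam y \<sigma>)\<^sup>2 = \<sigma>\<^sup>2 * y\<^sup>2 / (y\<^sup>2 + 2 * lam * \<sigma>\<^sup>2)"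
    by (simp add: param_map_def power_divide power_mult_distrib)
  then show ?thesis
    using assms by (simp add: field_simps)
qed

text \<open>The constant is the likelihood's prefactor \<open>2 * lam / y ^ 3\<close> times the
  quotient of the two normalisers, the common \<open>2 / sqrt (2 * pi)\<close> having cancelled. It
  is the value of the marginal at \<open>y\<close>.\<close>

lemma lik_times_nu_density:
  fixes \<delta> lam y \<sigma> :: real and i :: nat
  defines "a \<equiv> \<delta> - 1 + 2 * real i" and "T \<equiv> param_map lam y \<sigma>"
  assumes "\<delta> \<ge> 1" "lam > 0" "y > 0" "\<sigma> > 0"
  shows "lik lam x y * nu_density \<delta> i \<sigma> x =
    (2 * lam / y ^ 3) * (gauss_moment (a + 2) * T powr (a + 2) * T /
      (gauss_moment a * \<sigma> powr a * \<sigma>)) * nu_density \<delta> (index_map i) T x"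
proof (cases "x > 0")
  case False
  then show ?thesis by (simp add: nu_density_def)
next
  case True
  have T: "T > 0"
    unfolding T_def using assms by (intro param_map_pos)
  \<comment> \<open>Together with \<open>T > 0\<close>, this lets the normalisers of the posterior
    cancel in the final simplification.\<close>
  have C: "gauss_moment a > 0" "gauss_moment (a + 2) > 0"
    using assms by (auto intro!: gauss_moment_pos)
  have a2: "\<delta> - 1 + 2 * real (index_map i) = a + 2"
    by (simp add: a_def index_map_def)
  \<comment> \<open>Positivity of \<open>x\<close> allows \<open>powr\<close> with exponent 2 to be
    read as the square occurring in \<open>lik\<close>.\<close>
  have x2: "x powr (a + 2) = x powr a * x\<^sup>2"
    using True by (simp add: powr_add)
  have ex: "exp (- (x\<^sup>2 / (2 * T\<^sup>2))) = exp (- (lam * x\<^sup>2 / y\<^sup>2)) * exp (- (x\<^sup>2 / (2 * \<sigma>\<^sup>2)))"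
    unfolding T_def using assms by (subst precision_param_map) (auto simp: exp_add[symmetric])
  show ?thesis
    unfolding nu_density_def a2 ex lik_def a_def[symmetric] x2
    using True T C assms by (simp add: mult_ac)
qed

text \<open>The target belongs to the family again, so its total mass is already known to be 1; this
  fixes the marginal without evaluating a new integral.\<close>

lemma update_nu:
  assumes "\<delta> \<ge> 1" "lam > 0" "y > 0" "\<sigma> > 0"
  shows "update (lik lam) y (nu \<delta> i \<sigma>) = nu \<delta> (index_map i) (param_map lam y \<sigma>)"
  unfolding nu_eq_density
proof -
  define a T where "a = \<delta> - 1 + 2 * real i" and "T = param_map lam y \<sigma>"
  define K where "K = (2 * lam / y ^ 3) * (gauss_moment (a + 2) * T powr (a + 2) * T /
      (gauss_moment a * \<sigma> powr a * \<sigma>))"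
  have T: "T > 0"
    unfolding T_def using assms by (intro param_map_pos)
  have "gauss_moment a > 0" "gauss_moment (a + 2) > 0"
    using assms by (auto simp: a_def intro!: gauss_moment_pos)
  then have K: "K > 0"
    using assms T by (simp add: K_def)
  have "lik lam x y * nu_density \<delta> i \<sigma> x = K * nu_density \<delta> (index_map i) T x" for x
    unfolding K_def a_def T_def by (rule lik_times_nu_density[OF assms])
  moreover have "(\<lambda>x. lik lam x y) \<in> borel_measurable lborel"
    unfolding lik_def by measurable
  moreover have "nu_density \<delta> (index_map i) T x = 0" if "x \<le> 0" for x
    using that by (simp add: nu_density_def)
  ultimately have "update (lik lam) y (density lborel (\<lambda>x. ennreal (nu_density \<delta> i \<sigma> x))) =
      density lborel (\<lambda>x. ennreal (nu_density \<delta> (index_map i) T x))"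
    using K assms nu_density_nonneg nn_integral_nu_density[OF assms(1) T]
    by (intro update_density[where K = K]) simp_all
  then show "update (lik lam) y (density lborel (\<lambda>x. ennreal (nu_density \<delta> i \<sigma> x))) =
      density lborel (\<lambda>x. ennreal (nu_density \<delta> (index_map i) (param_map lam y \<sigma>) x))"
    unfolding T_def .
qed

theorem proposition4p2:
  fixes \<delta> lam y :: real
  assumes "\<delta> \<ge> 1" and "lam > 0" and "y > 0"
  shows "(\<forall>i::nat. \<forall>\<sigma>>0. param_map lam y \<sigma> > 0 \<and>
            update (lik lam) y (nu \<delta> i \<sigma>) = nu \<delta> (index_map i) (param_map lam y \<sigma>))
       \<and> update (lik lam) y ` nu_family \<delta> \<subseteq> nu_family \<delta>
       \<and> inj index_map"
proof (intro conjI)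
  show *: "\<forall>i::nat. \<forall>\<sigma>>0. param_map lam y \<sigma> > 0 \<and>
            update (lik lam) y (nu \<delta> i \<sigma>) = nu \<delta> (index_map i) (param_map lam y \<sigma>)"
    using assms param_map_pos update_nu by blast
  show "update (lik lam) y ` nu_family \<delta> \<subseteq> nu_family \<delta>"
    \<comment> \<open>The positivity conjunct of \<open>*\<close> supplies the side condition for
      membership in the family.\<close>
    unfolding nu_family_def using * by blast
  show "inj index_map"
    by (simp add: inj_def index_map_def)
qed

end
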